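(* Let $p\equiv 3\pmod 4$ be an odd prime. Let $A\geq C\geq 1$ and $B\geq D\geq 1$ be integers, and let $\alpha,\beta,\gamma,\delta$ be integers with $$1\leq\gamma\leq\alpha\leq p-1,\qquad 1\leq\delta\leq\beta\leq p-1.$$ Then $$\mathcal R(pA+\alpha,pB+\beta;pC+\gamma,pD+\delta)\equiv \mathcal R(A,B;C,D)\,\mathcal R(\alpha,\beta;\gamma,\delta)\binom{\alpha}{\gamma}^{D}\binom{\beta}{\delta}^{C}\pmod p.$$
   Context: For integers $A\geq C\geq 1$ and $B\geq D\geq 1$, the rectangular Gaussian binomial coefficient is the element of $\mathbb Q(i)$ $$\mathcal R(A,B;C,D):=\frac{\prod_{n=0}^{C-1}\prod_{m=0}^{D-1}\bigl(A+Bi-(n+mi)\bigr)}{\prod_{n=1}^{C}\prod_{m=1}^{D}(n+mi)}=\frac{\prod_{x=A-C+1}^{A}\prod_{y=B-D+1}^{B}(x+iy)}{\prod_{x=1}^{C}\prod_{y=1}^{D}(x+iy)}.$$ For a prime $p\equiv 3\pmod 4$, $\mathbb Q(i)$ is viewed inside $\mathbb Q_p(i)$, the unramified quadratic extension of $\mathbb Q_p$, whose ring of integers is $\mathbb Z_p[i]$. Congruences are interpreted locally: $X\equiv Y\pmod{p^r}$ means $X-Y\in p^r\mathbb Z_p[i]$. The symbols $\binom{\alpha}{\gamma},\binom{\beta}{\delta}$ are ordinary binomial coefficients. *)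

theory Defs
  imports Complex_Main "HOL-Algebra.QuotRing" "HOL-Computational_Algebra.Primes"
begin

section \<open>Rectangular Gaussian binomial coefficients\<close>

text \<open>
  The field \<open>\<rat>(\<i>)\<close> is taken as a subset of the complex numbers.
\<close>

definition gauss_rats :: "complex set" where
  "gauss_rats = {z. Re z \<in> \<rat> \<and> Im z \<in> \<rat>}"

definition rect_binom :: "nat \<Rightarrow> nat \<Rightarrow> nat \<Rightarrow> nat \<Rightarrow> complex" where
  "rect_binom A B C D =
     (\<Prod>n = 0..<C. \<Prod>m = 0..<D.
        (of_nat A + of_nat B * \<i>) - (of_nat n + of_nat m * \<i>)) /
     (\<Prod>n = 1..C. \<Prod>m = 1..D. of_nat n + of_nat m * \<i>)"

lemma rect_binom_altdef:
  assumes "C \<le> A" "D \<le> B"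
  shows "rect_binom A B C D =
     (\<Prod>x = A - C + 1..A. \<Prod>y = B - D + 1..B. of_nat x + \<i> * of_nat y) /
     (\<Prod>x = 1..C. \<Prod>y = 1..D. of_nat x + \<i> * of_nat y)"
proof -
  have reidx: "(\<Prod>n = 0..<C'. g n) = (\<Prod>x = A' - C' + 1..A'. g (A' - x))"
    if "C' \<le> A'" for A' C' :: nat and g :: "nat \<Rightarrow> complex"
    by (rule prod.reindex_bij_witness[of _ "\<lambda>x. A' - x" "\<lambda>n. A' - n"])
       (use that in \<open>auto simp: diff_diff_cancel[OF less_imp_le[OF less_le_trans]]\<close>)
  have "(\<Prod>n = 0..<C. \<Prod>m = 0..<D.
        (of_nat A + of_nat B * \<i>) - (of_nat n + of_nat m * \<i>)) =
      (\<Prod>x = A - C + 1..A. \<Prod>y = B - D + 1..B.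
        (of_nat A + of_nat B * \<i>) - (of_nat (A - x) + of_nat (B - y) * \<i>))"
    using reidx[OF assms(1)] reidx[OF assms(2)] by simp
  also have "\<dots> = (\<Prod>x = A - C + 1..A. \<Prod>y = B - D + 1..B. of_nat x + \<i> * of_nat y)"
    by (intro prod.cong refl) (auto simp: of_nat_diff algebra_simps)
  finally show ?thesis
    by (simp add: rect_binom_def mult.commute)
qed

lemma gauss_rats_of_nat [simp]: "of_nat n \<in> gauss_rats"
  and gauss_rats_ii [simp]: "\<i> \<in> gauss_rats"
  and gauss_rats_add: "x \<in> gauss_rats \<Longrightarrow> y \<in> gauss_rats \<Longrightarrow> x + y \<in> gauss_rats"
  and gauss_rats_diff: "x \<in> gauss_rats \<Longrightarrow> y \<in> gauss_rats \<Longrightarrow> x - y \<in> gauss_rats"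
  and gauss_rats_mult: "x \<in> gauss_rats \<Longrightarrow> y \<in> gauss_rats \<Longrightarrow> x * y \<in> gauss_rats"
  and gauss_rats_divide: "x \<in> gauss_rats \<Longrightarrow> y \<in> gauss_rats \<Longrightarrow> x / y \<in> gauss_rats"
  by (auto simp: gauss_rats_def Re_divide Im_divide)

lemma gauss_rats_power: "x \<in> gauss_rats \<Longrightarrow> x ^ n \<in> gauss_rats"
  by (induction n) (auto intro: gauss_rats_mult simp: gauss_rats_of_nat[of 1, simplified])

lemma gauss_rats_prod: "(\<And>x. x \<in> S \<Longrightarrow> f x \<in> gauss_rats) \<Longrightarrow> prod f S \<in> gauss_rats"
  by (induction S rule: infinite_finite_induct)
     (auto intro: gauss_rats_mult simp: gauss_rats_of_nat[of 1, simplified])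

lemma rect_binom_in_gauss_rats: "rect_binom A B C D \<in> gauss_rats"
  unfolding rect_binom_def
  by (intro gauss_rats_divide gauss_rats_prod gauss_rats_diff gauss_rats_add gauss_rats_mult
      gauss_rats_of_nat gauss_rats_ii)


section \<open>The \<open>p\<close>-adic absolute value on the rationals\<close>

definition padic_abs :: "nat \<Rightarrow> rat \<Rightarrow> real" where
  "padic_abs p q = (if q = 0 then 0 else
     (case quotient_of q of (a, b) \<Rightarrow>
        real p powi (int (multiplicity (int p) b) - int (multiplicity (int p) a))))"

lemma padic_abs_0 [simp]: "padic_abs p 0 = 0"
  by (simp add: padic_abs_def)

lemma padic_abs_fraction:
  assumes p: "prime p" and ab: "a \<noteq> 0" "b \<noteq> 0"
  shows "padic_abs p (of_int a / of_int b) =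
    real p powi (int (multiplicity (int p) b) - int (multiplicity (int p) a))"
proof -
  obtain c d where cd: "quotient_of (of_int a / of_int b) = (c, d)" by fastforce
  have pp: "prime_elem (int p)" using p by simp
  have d: "d > 0" using quotient_of_denom_pos[OF cd] .
  have eq: "(of_int a / of_int b :: rat) = of_int c / of_int d"
    using quotient_of_div[OF cd] .
  hence "(of_int (a * d) :: rat) = of_int (c * b)"
    using ab d by (simp add: field_simps)
  hence e: "a * d = c * b" using of_int_eq_iff by blast
  have c: "c \<noteq> 0" using e ab d by auto
  have "multiplicity (int p) a + multiplicity (int p) d =
      multiplicity (int p) c + multiplicity (int p) b"
    using arg_cong[OF e, of "multiplicity (int p)"] pp ab c d
    by (simp add: prime_elem_multiplicity_mult_distrib)
  hence "int (multiplicity (int p) d) - int (multiplicity (int p) c) =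
      int (multiplicity (int p) b) - int (multiplicity (int p) a)" by linarith
  thus ?thesis using ab cd by (simp add: padic_abs_def)
qed

lemma rat_fraction_cases:
  fixes q :: rat
  obtains a b :: int where "b \<noteq> 0" "q = of_int a / of_int b"
proof -
  obtain c d where cd: "quotient_of q = (c, d)" by fastforce
  show thesis
    using that[of d c] quotient_of_denom_pos[OF cd] quotient_of_div[OF cd] by simp
qed

lemma padic_abs_mult:
  assumes p: "prime p"
  shows "padic_abs p (x * y) = padic_abs p x * padic_abs p y"
proof (cases "x = 0 \<or> y = 0")
  case False
  obtain a b where x: "b \<noteq> 0" "x = of_int a / of_int b" by (rule rat_fraction_cases)
  obtain c d where y: "d \<noteq> 0" "y = of_int c / of_int d" by (rule rat_fraction_cases)
  have nz: "a \<noteq> 0" "c \<noteq> 0" using False x y by auto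
  have xy: "x * y = of_int (a * c) / of_int (b * d)" using x y by simp
  have p0: "real p \<noteq> 0" using p by (simp add: prime_gt_0_nat)
  have pp: "prime_elem (int p)" using p by simp
  show ?thesis
    unfolding xy using x y nz p0 pp
    by (subst padic_abs_fraction)
       (auto simp: p padic_abs_fraction prime_elem_multiplicity_mult_distrib
         simp flip: power_int_add intro!: arg_cong[where f = "\<lambda>k. real p powi k"])
qed auto

lemma padic_abs_nonneg [simp]: "padic_abs p x \<ge> 0"
  by (auto simp: padic_abs_def split: prod.splits)

lemma padic_abs_1 [simp]: "padic_abs p 1 = 1"
  by (simp add: padic_abs_def)

lemma multiplicity_uminus: "multiplicity (a :: int) (- b) = multiplicity a b"
  by (simp add: multiplicity_def)

lemma padic_abs_minus [simp]: "padic_abs p (- x) = padic_abs p x"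
  by (auto simp: padic_abs_def rat_uminus_code Let_def multiplicity_uminus split: prod.splits)

lemma padic_abs_eq_0_iff:
  assumes "prime p"
  shows "padic_abs p x = 0 \<longleftrightarrow> x = 0"
  using assms by (auto simp: padic_abs_def prime_gt_0_nat split: prod.splits)

lemma padic_abs_power_prime:
  assumes "prime p"
  shows "padic_abs p (of_nat (p ^ r)) = 1 / real p ^ r"
  using padic_abs_fraction[OF assms, of "int (p ^ r)" 1] assms
  by (simp add: power_int_minus divide_inverse)

lemma padic_abs_ultrametric:
  assumes p: "prime p"
  shows "padic_abs p (x + y) \<le> max (padic_abs p x) (padic_abs p y)"
proof (cases "x = 0 \<or> y = 0 \<or> x + y = 0")
  case True
  thus ?thesis by (auto simp: max_def)
next
  case False
  obtain a b where x: "b \<noteq> 0" "x = of_int a / of_int b" by (rule rat_fraction_cases)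
  obtain c d where y: "d \<noteq> 0" "y = of_int c / of_int d" by (rule rat_fraction_cases)
  define u v w where "u = a * d" and "v = c * b" and "w = b * d"
  have w: "w \<noteq> 0" and xy: "x = of_int u / of_int w" "y = of_int v / of_int w"
    "x + y = of_int (u + v) / of_int w"
    using x y by (auto simp: u_def v_def w_def field_simps)
  have nz: "u \<noteq> 0" "v \<noteq> 0" "u + v \<noteq> 0" using False xy by auto
  define k where "k = min (multiplicity (int p) u) (multiplicity (int p) v)"
  have "int p ^ k dvd u + v"
    by (intro dvd_add) (auto simp: k_def intro!: multiplicity_dvd')
  hence k: "multiplicity (int p) (u + v) \<ge> k"
    using nz(3) prime_gt_1_nat[OF p] by (intro multiplicity_geI) auto
  have "padic_abs p (x + y) \<le> real p powi (int (multiplicity (int p) w) - int k)"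
    unfolding xy(3) padic_abs_fraction[OF p nz(3) w]
    using k prime_ge_1_nat[OF p] by (intro power_int_increasing) auto
  also have "\<dots> \<le> max (padic_abs p x) (padic_abs p y)"
    unfolding xy(1,2) padic_abs_fraction[OF p nz(1) w] padic_abs_fraction[OF p nz(2) w]
    by (auto simp: k_def min_def max_def)
  finally show ?thesis .
qed

lemma padic_abs_triangle:
  assumes p: "prime p"
  shows "padic_abs p (x + y) \<le> padic_abs p x + padic_abs p y"
  using padic_abs_ultrametric[OF p, of x y] padic_abs_nonneg[of p x] padic_abs_nonneg[of p y]
  by linarith

lemma padic_abs_diff_commute: "padic_abs p (x - y) = padic_abs p (y - x)"
  by (metis minus_diff_eq padic_abs_minus)

lemma padic_abs_reverse_triangle:
  assumes p: "prime p"
  shows "\<bar>padic_abs p x - padic_abs p y\<bar> \<le> padic_abs p (x - y)"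
  using padic_abs_triangle[OF p, of "x - y" y] padic_abs_triangle[OF p, of "y - x" x]
    padic_abs_diff_commute[of p x y] by simp


section \<open>The \<open>p\<close>-adic numbers\<close>

text \<open>
  \<open>\<rat>\<^sub>p\<close> is the completion of \<open>\<rat>\<close>: the ring of sequences that are Cauchy for the
  \<open>p\<close>-adic absolute value, modulo the ideal of null sequences.
\<close>

definition padic_Cauchy :: "nat \<Rightarrow> (nat \<Rightarrow> rat) set" where
  "padic_Cauchy p = {s. \<forall>e>0. \<exists>N. \<forall>m\<ge>N. \<forall>n\<ge>N. padic_abs p (s m - s n) < e}"

definition padic_null :: "nat \<Rightarrow> (nat \<Rightarrow> rat) set" where
  "padic_null p = {s. (\<lambda>n. padic_abs p (s n)) \<longlonglongrightarrow> 0}"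

definition padic_Cauchy_ring :: "nat \<Rightarrow> (nat \<Rightarrow> rat) ring" where
  "padic_Cauchy_ring p =
     \<lparr>carrier = padic_Cauchy p,
      monoid.mult = (\<lambda>s t n. s n * t n), one = (\<lambda>n. 1),
      zero = (\<lambda>n. 0), add = (\<lambda>s t n. s n + t n)\<rparr>"

definition padic_numbers :: "nat \<Rightarrow> (nat \<Rightarrow> rat) set ring" where
  "padic_numbers p = padic_Cauchy_ring p Quot padic_null p"

definition padic_of_rat :: "nat \<Rightarrow> rat \<Rightarrow> (nat \<Rightarrow> rat) set" where
  "padic_of_rat p q = padic_null p +>\<^bsub>padic_Cauchy_ring p\<^esub> (\<lambda>n. q)"

text \<open>
  The absolute value of a class is the limit of the absolute values along any
  representing sequence; see \<open>padic_norm_coset\<close> below.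
\<close>

definition padic_norm :: "nat \<Rightarrow> (nat \<Rightarrow> rat) set \<Rightarrow> real" where
  "padic_norm p x = (THE l. \<exists>s\<in>x. (\<lambda>n. padic_abs p (s n)) \<longlonglongrightarrow> l)"

definition padic_ints :: "nat \<Rightarrow> (nat \<Rightarrow> rat) set set" where
  "padic_ints p = {x \<in> carrier (padic_numbers p). padic_norm p x \<le> 1}"


section \<open>The extension by \<open>\<i>\<close> and local congruences\<close>

text \<open>
  \<open>R[\<i>] = R[X]/(X\<^sup>2 + 1)\<close>, with the pair \<open>(a, b)\<close> standing for \<open>a + b\<i>\<close>. Over \<open>\<rat>\<^sub>p\<close> with
  \<open>p\<close> congruent to \<open>3\<close> modulo \<open>4\<close> this is the field \<open>\<rat>\<^sub>p(\<i>)\<close>.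
\<close>

definition adjoin_ii :: "('a, 'm) ring_scheme \<Rightarrow> ('a \<times> 'a) ring" where
  "adjoin_ii R =
     \<lparr>carrier = carrier R \<times> carrier R,
      monoid.mult = (\<lambda>(a, b) (c, d).
        ((a \<otimes>\<^bsub>R\<^esub> c) \<ominus>\<^bsub>R\<^esub> (b \<otimes>\<^bsub>R\<^esub> d), (a \<otimes>\<^bsub>R\<^esub> d) \<oplus>\<^bsub>R\<^esub> (b \<otimes>\<^bsub>R\<^esub> c))),
      one = (\<one>\<^bsub>R\<^esub>, \<zero>\<^bsub>R\<^esub>),
      zero = (\<zero>\<^bsub>R\<^esub>, \<zero>\<^bsub>R\<^esub>),
      add = (\<lambda>(a, b) (c, d). (a \<oplus>\<^bsub>R\<^esub> c, b \<oplus>\<^bsub>R\<^esub> d))\<rparr>"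

definition padic_gauss_numbers :: "nat \<Rightarrow> ((nat \<Rightarrow> rat) set \<times> (nat \<Rightarrow> rat) set) ring" where
  "padic_gauss_numbers p = adjoin_ii (padic_numbers p)"

definition padic_gauss_ints :: "nat \<Rightarrow> ((nat \<Rightarrow> rat) set \<times> (nat \<Rightarrow> rat) set) set" where
  "padic_gauss_ints p = padic_ints p \<times> padic_ints p"

definition rat_of_real :: "real \<Rightarrow> rat" where
  "rat_of_real x = (THE q. of_rat q = x)"

text \<open>The embedding of \<open>\<rat>(\<i>)\<close> into \<open>\<rat>\<^sub>p(\<i>)\<close>, meaningful on \<^const>\<open>gauss_rats\<close> only.\<close>

definition padic_of_gauss :: "nat \<Rightarrow> complex \<Rightarrow> (nat \<Rightarrow> rat) set \<times> (nat \<Rightarrow> rat) set" where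
  "padic_of_gauss p z =
     (padic_of_rat p (rat_of_real (Re z)), padic_of_rat p (rat_of_real (Im z)))"

definition padic_gauss_cong :: "nat \<Rightarrow> nat \<Rightarrow> complex \<Rightarrow> complex \<Rightarrow> bool" where
  "padic_gauss_cong p r X Y \<longleftrightarrow> X \<in> gauss_rats \<and> Y \<in> gauss_rats \<and>
     (\<exists>z \<in> padic_gauss_ints p.
        padic_of_gauss p X \<ominus>\<^bsub>padic_gauss_numbers p\<^esub> padic_of_gauss p Y =
        padic_of_gauss p (of_nat (p ^ r)) \<otimes>\<^bsub>padic_gauss_numbers p\<^esub> z)"


section \<open>Basic properties of the construction\<close>

lemma padic_Cauchy_const [simp]: "(\<lambda>n. q) \<in> padic_Cauchy p"
  by (auto simp: padic_Cauchy_def)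

lemma padic_Cauchy_norm_Cauchy:
  assumes p: "prime p" and s: "s \<in> padic_Cauchy p"
  shows "Cauchy (\<lambda>n. padic_abs p (s n))"
  unfolding Cauchy_def dist_real_def
proof (intro allI impI)
  fix e :: real assume "e > 0"
  then obtain N where N: "\<forall>m\<ge>N. \<forall>n\<ge>N. padic_abs p (s m - s n) < e"
    using s by (auto simp: padic_Cauchy_def)
  show "\<exists>M. \<forall>m\<ge>M. \<forall>n\<ge>M. \<bar>padic_abs p (s m) - padic_abs p (s n)\<bar> < e"
    using N padic_abs_reverse_triangle[OF p] by (meson le_less_trans)
qed

lemma padic_Cauchy_bounded:
  assumes p: "prime p" and s: "s \<in> padic_Cauchy p"
  obtains K where "K > 0" "\<And>n. padic_abs p (s n) \<le> K"
proof -
  have "Bseq (\<lambda>n. padic_abs p (s n))"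
    using padic_Cauchy_norm_Cauchy[OF assms] by (rule Cauchy_Bseq)
  thus ?thesis using that by (auto simp: Bseq_def)
qed

lemma padic_Cauchy_add:
  assumes p: "prime p" and s: "s \<in> padic_Cauchy p" and t: "t \<in> padic_Cauchy p"
  shows "(\<lambda>n. s n + t n) \<in> padic_Cauchy p"
  unfolding padic_Cauchy_def
proof (safe)
  fix e :: real assume "e > 0"
  obtain M where M: "\<forall>m\<ge>M. \<forall>n\<ge>M. padic_abs p (s m - s n) < e"
    using s \<open>e > 0\<close> by (auto simp: padic_Cauchy_def)
  obtain N where N: "\<forall>m\<ge>N. \<forall>n\<ge>N. padic_abs p (t m - t n) < e"
    using t \<open>e > 0\<close> by (auto simp: padic_Cauchy_def)
  have "padic_abs p ((s m + t m) - (s n + t n)) < e" if "m \<ge> max M N" "n \<ge> max M N" for m n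
    using padic_abs_ultrametric[OF p, of "s m - s n" "t m - t n"] M N that
    by (auto simp: add_diff_add intro: le_less_trans)
  thus "\<exists>N. \<forall>m\<ge>N. \<forall>n\<ge>N. padic_abs p ((s m + t m) - (s n + t n)) < e" by blast
qed

lemma padic_Cauchy_minus:
  assumes "s \<in> padic_Cauchy p"
  shows "(\<lambda>n. - s n) \<in> padic_Cauchy p"
proof -
  have "padic_abs p (- s m - - s n) = padic_abs p (s m - s n)" for m n
    using padic_abs_diff_commute[of p "s m" "s n"] by (simp only: minus_diff_minus padic_abs_minus)
  thus ?thesis using assms by (simp only: padic_Cauchy_def mem_Collect_eq)
qed

lemma padic_Cauchy_mult:
  assumes p: "prime p" and s: "s \<in> padic_Cauchy p" and t: "t \<in> padic_Cauchy p"
  shows "(\<lambda>n. s n * t n) \<in> padic_Cauchy p"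
  unfolding padic_Cauchy_def
proof (safe)
  fix e :: real assume e: "e > 0"
  obtain K where K: "K > 0" "\<And>n. padic_abs p (s n) \<le> K"
    using padic_Cauchy_bounded[OF p s] by blast
  obtain L where L: "L > 0" "\<And>n. padic_abs p (t n) \<le> L"
    using padic_Cauchy_bounded[OF p t] by blast
  obtain M where M: "\<forall>m\<ge>M. \<forall>n\<ge>M. padic_abs p (s m - s n) < e / L"
    using s divide_pos_pos[OF e L(1)] unfolding padic_Cauchy_def by blast
  obtain N where N: "\<forall>m\<ge>N. \<forall>n\<ge>N. padic_abs p (t m - t n) < e / K"
    using t divide_pos_pos[OF e K(1)] unfolding padic_Cauchy_def by blast
  have "padic_abs p (s m * t m - s n * t n) < e" if mn: "m \<ge> max M N" "n \<ge> max M N" for m n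
  proof -
    have "padic_abs p (s m * (t m - t n)) \<le> K * padic_abs p (t m - t n)"
      unfolding padic_abs_mult[OF p] using K by (intro mult_right_mono) auto
    also have "\<dots> < e" using N mn K by (auto simp: field_simps)
    finally have 1: "padic_abs p (s m * (t m - t n)) < e" .
    have "padic_abs p ((s m - s n) * t n) \<le> padic_abs p (s m - s n) * L"
      unfolding padic_abs_mult[OF p] using L by (intro mult_left_mono) auto
    also have "\<dots> < e" using M mn L by (auto simp: field_simps)
    finally have 2: "padic_abs p ((s m - s n) * t n) < e" .
    show ?thesis
      using padic_abs_ultrametric[OF p, of "s m * (t m - t n)" "(s m - s n) * t n"] 1 2
      by (auto simp: algebra_simps)
  qed
  thus "\<exists>N. \<forall>m\<ge>N. \<forall>n\<ge>N. padic_abs p (s m * t m - s n * t n) < e" by blast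
qed

lemma padic_null_Cauchy:
  assumes p: "prime p" and s: "s \<in> padic_null p"
  shows "s \<in> padic_Cauchy p"
  unfolding padic_Cauchy_def
proof (safe)
  fix e :: real assume "e > 0"
  then obtain N where N: "\<forall>n\<ge>N. padic_abs p (s n) < e"
    using s by (auto simp: padic_null_def LIMSEQ_iff)
  have "padic_abs p (s m - s n) < e" if "m \<ge> N" "n \<ge> N" for m n
    using padic_abs_ultrametric[OF p, of "s m" "- s n"] N that by (auto intro: le_less_trans)
  thus "\<exists>N. \<forall>m\<ge>N. \<forall>n\<ge>N. padic_abs p (s m - s n) < e" by blast
qed

lemma padic_Cauchy_ring_cring:
  assumes p: "prime p"
  shows "cring (padic_Cauchy_ring p)"
proof (rule cringI)
  show "abelian_group (padic_Cauchy_ring p)"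
  proof (rule abelian_groupI)
    fix s assume "s \<in> carrier (padic_Cauchy_ring p)"
    thus "\<exists>t\<in>carrier (padic_Cauchy_ring p). t \<oplus>\<^bsub>padic_Cauchy_ring p\<^esub> s = \<zero>\<^bsub>padic_Cauchy_ring p\<^esub>"
      by (intro bexI[of _ "\<lambda>n. - s n"]) (auto simp: padic_Cauchy_ring_def padic_Cauchy_minus)
  qed (auto simp: padic_Cauchy_ring_def padic_Cauchy_add[OF p] add_ac)
  show "comm_monoid (padic_Cauchy_ring p)"
    by (rule comm_monoidI) (auto simp: padic_Cauchy_ring_def padic_Cauchy_mult[OF p] mult_ac)
qed (auto simp: padic_Cauchy_ring_def distrib_right)

lemma padic_Cauchy_ring_uminus:
  assumes p: "prime p" and s: "s \<in> padic_Cauchy p"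
  shows "\<ominus>\<^bsub>padic_Cauchy_ring p\<^esub> s = (\<lambda>n. - s n)"
proof -
  interpret cring "padic_Cauchy_ring p" by (rule padic_Cauchy_ring_cring[OF p])
  show ?thesis
    by (rule minus_equality) (use s in \<open>auto simp: padic_Cauchy_ring_def padic_Cauchy_minus\<close>)
qed

lemma padic_null_ideal:
  assumes p: "prime p"
  shows "ideal (padic_null p) (padic_Cauchy_ring p)"
proof -
  interpret cring "padic_Cauchy_ring p" by (rule padic_Cauchy_ring_cring[OF p])
  have mult: "(\<lambda>n. s n * t n) \<in> padic_null p" if s: "s \<in> padic_null p" and t: "t \<in> padic_Cauchy p" for s t
  proof -
    obtain K where K: "K > 0" "\<And>n. padic_abs p (t n) \<le> K"
      using padic_Cauchy_bounded[OF p t] by blast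
    have lim: "(\<lambda>n. padic_abs p (s n) * K) \<longlonglongrightarrow> 0"
      using s tendsto_mult_left_zero unfolding padic_null_def by blast
    have "(\<lambda>n. padic_abs p (s n * t n)) \<longlonglongrightarrow> 0"
      by (rule tendsto_sandwich[OF _ _ tendsto_const lim])
         (auto simp: padic_abs_mult[OF p] K intro!: mult_left_mono always_eventually)
    thus ?thesis by (simp add: padic_null_def)
  qed
  have add: "(\<lambda>n. s n + t n) \<in> padic_null p" if s: "s \<in> padic_null p" and t: "t \<in> padic_null p" for s t
  proof -
    have lim: "(\<lambda>n. padic_abs p (s n) + padic_abs p (t n)) \<longlonglongrightarrow> 0"
      using tendsto_add[of "\<lambda>n. padic_abs p (s n)" 0 _ "\<lambda>n. padic_abs p (t n)" 0] s t
      by (simp add: padic_null_def)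
    have "(\<lambda>n. padic_abs p (s n + t n)) \<longlonglongrightarrow> 0"
      by (rule tendsto_sandwich[OF _ _ tendsto_const lim])
         (auto simp: padic_abs_triangle[OF p])
    thus ?thesis by (simp add: padic_null_def)
  qed
  show ?thesis
  proof (rule idealI)
    show "ring (padic_Cauchy_ring p)" by unfold_locales
    show "subgroup (padic_null p) (add_monoid (padic_Cauchy_ring p))"
    proof (rule add.subgroupI)
      show "padic_null p \<subseteq> carrier (padic_Cauchy_ring p)"
        using padic_null_Cauchy[OF p] by (auto simp: padic_Cauchy_ring_def)
      have "(\<lambda>n. 0) \<in> padic_null p" by (simp add: padic_null_def)
      thus "padic_null p \<noteq> {}" by blast
      fix s assume s: "s \<in> padic_null p"
      show "\<ominus>\<^bsub>padic_Cauchy_ring p\<^esub> s \<in> padic_null p"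
        using s by (simp add: padic_Cauchy_ring_uminus[OF p padic_null_Cauchy[OF p s]])
          (simp add: padic_null_def)
      fix t assume t: "t \<in> padic_null p"
      show "s \<oplus>\<^bsub>padic_Cauchy_ring p\<^esub> t \<in> padic_null p"
        using add[OF s t] by (simp add: padic_Cauchy_ring_def)
    qed
  qed (auto simp: padic_Cauchy_ring_def mult mult.commute)
qed

lemma padic_numbers_cring:
  assumes p: "prime p"
  shows "cring (padic_numbers p)"
  unfolding padic_numbers_def
  by (rule ideal.quotient_is_cring[OF padic_null_ideal[OF p] padic_Cauchy_ring_cring[OF p]])

abbreviation padic_coset :: "nat \<Rightarrow> (nat \<Rightarrow> rat) \<Rightarrow> (nat \<Rightarrow> rat) set" where
  "padic_coset p s \<equiv> padic_null p +>\<^bsub>padic_Cauchy_ring p\<^esub> s"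

lemma padic_coset_hom:
  assumes p: "prime p"
  shows "padic_coset p \<in> ring_hom (padic_Cauchy_ring p) (padic_numbers p)"
  unfolding padic_numbers_def using ideal.rcos_ring_hom[OF padic_null_ideal[OF p]] .

lemma carrier_padic_numbers:
  "carrier (padic_numbers p) = padic_coset p ` padic_Cauchy p"
  by (auto simp: padic_numbers_def FactRing_def A_RCOSETS_def' padic_Cauchy_ring_def)

lemma in_padic_coset_iff:
  "t \<in> padic_coset p s \<longleftrightarrow> (\<lambda>n. padic_abs p (t n - s n)) \<longlonglongrightarrow> 0"
proof -
  have "t \<in> padic_coset p s \<longleftrightarrow> (\<exists>h\<in>padic_null p. t = (\<lambda>n. h n + s n))"
    by (auto simp: a_r_coset_def' padic_Cauchy_ring_def)
  also have "\<dots> \<longleftrightarrow> (\<lambda>n. t n - s n) \<in> padic_null p"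
    by (auto intro!: bexI[of _ "\<lambda>n. t n - s n"])
  finally show ?thesis by (simp add: padic_null_def)
qed

lemma padic_norm_coset:
  assumes p: "prime p" and s: "s \<in> padic_Cauchy p"
  shows "(\<lambda>n. padic_abs p (s n)) \<longlonglongrightarrow> padic_norm p (padic_coset p s)"
proof -
  obtain l where l: "(\<lambda>n. padic_abs p (s n)) \<longlonglongrightarrow> l"
    using padic_Cauchy_norm_Cauchy[OF p s] Cauchy_convergent convergent_def by blast
  have 1: "(\<lambda>n. padic_abs p (t n)) \<longlonglongrightarrow> l" if "t \<in> padic_coset p s" for t
  proof -
    have 0: "(\<lambda>n. padic_abs p (t n - s n)) \<longlonglongrightarrow> 0"
      using that by (simp add: in_padic_coset_iff)
    have "(\<lambda>n. padic_abs p (t n) - padic_abs p (s n)) \<longlonglongrightarrow> 0"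
      by (rule tendsto_rabs_zero_cancel,
          rule tendsto_sandwich[OF _ _ tendsto_const 0])
         (auto simp: padic_abs_reverse_triangle[OF p])
    from tendsto_add[OF this l] show ?thesis by simp
  qed
  have "s \<in> padic_coset p s" by (simp add: in_padic_coset_iff)
  hence "padic_norm p (padic_coset p s) = l"
    unfolding padic_norm_def using l 1 LIMSEQ_unique by (intro the_equality) blast+
  thus ?thesis using l by simp
qed

lemma padic_norm_mult:
  assumes p: "prime p" and x: "x \<in> carrier (padic_numbers p)" and y: "y \<in> carrier (padic_numbers p)"
  shows "padic_norm p (x \<otimes>\<^bsub>padic_numbers p\<^esub> y) = padic_norm p x * padic_norm p y"
proof -
  obtain s t where st: "s \<in> padic_Cauchy p" "x = padic_coset p s"
    "t \<in> padic_Cauchy p" "y = padic_coset p t"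
    using x y by (auto simp: carrier_padic_numbers)
  have "x \<otimes>\<^bsub>padic_numbers p\<^esub> y = padic_coset p (\<lambda>n. s n * t n)"
    using ring_hom_mult[OF padic_coset_hom[OF p], of s t] st by (simp add: padic_Cauchy_ring_def)
  moreover have "(\<lambda>n. padic_abs p (s n * t n)) \<longlonglongrightarrow> padic_norm p x * padic_norm p y"
    unfolding padic_abs_mult[OF p] st
    by (intro tendsto_mult padic_norm_coset p st)
  ultimately show ?thesis
    using padic_norm_coset[OF p padic_Cauchy_mult[OF p st(1,3)]] LIMSEQ_unique by metis
qed

lemma padic_norm_of_rat [simp]:
  assumes p: "prime p"
  shows "padic_norm p (padic_of_rat p q) = padic_abs p q"
  using padic_norm_coset[OF p padic_Cauchy_const] LIMSEQ_unique tendsto_const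
  unfolding padic_of_rat_def by blast

lemma padic_of_rat_closed [simp]: "padic_of_rat p q \<in> carrier (padic_numbers p)"
  by (auto simp: carrier_padic_numbers padic_of_rat_def)

lemma padic_of_rat_inj:
  assumes p: "prime p" and eq: "padic_of_rat p x = padic_of_rat p y"
  shows "x = y"
proof -
  have "(\<lambda>n. x) \<in> padic_of_rat p y"
    unfolding eq[symmetric] by (simp add: padic_of_rat_def in_padic_coset_iff)
  thus ?thesis
    by (simp add: padic_of_rat_def in_padic_coset_iff LIMSEQ_const_iff
        padic_abs_eq_0_iff[OF p])
qed

lemma
  assumes p: "prime p"
  shows padic_of_rat_add: "padic_of_rat p (x + y) = padic_of_rat p x \<oplus>\<^bsub>padic_numbers p\<^esub> padic_of_rat p y"
    and padic_of_rat_mult: "padic_of_rat p (x * y) = padic_of_rat p x \<otimes>\<^bsub>padic_numbers p\<^esub> padic_of_rat p y"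
    and padic_of_rat_1: "padic_of_rat p 1 = \<one>\<^bsub>padic_numbers p\<^esub>"
    and padic_of_rat_0: "padic_of_rat p 0 = \<zero>\<^bsub>padic_numbers p\<^esub>"
proof -
  note hom = padic_coset_hom[OF p]
  show "padic_of_rat p (x + y) = padic_of_rat p x \<oplus>\<^bsub>padic_numbers p\<^esub> padic_of_rat p y"
    using ring_hom_add[OF hom, of "\<lambda>n. x" "\<lambda>n. y"]
    by (simp add: padic_Cauchy_ring_def padic_of_rat_def)
  show "padic_of_rat p (x * y) = padic_of_rat p x \<otimes>\<^bsub>padic_numbers p\<^esub> padic_of_rat p y"
    using ring_hom_mult[OF hom, of "\<lambda>n. x" "\<lambda>n. y"]
    by (simp add: padic_Cauchy_ring_def padic_of_rat_def)
  show "padic_of_rat p 1 = \<one>\<^bsub>padic_numbers p\<^esub>"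
    using ring_hom_one[OF hom] by (simp add: padic_Cauchy_ring_def padic_of_rat_def)
  show "padic_of_rat p 0 = \<zero>\<^bsub>padic_numbers p\<^esub>"
    using ring_hom_zero[OF hom cring.axioms(1)[OF padic_Cauchy_ring_cring[OF p]]
        cring.axioms(1)[OF padic_numbers_cring[OF p]]]
    by (simp add: padic_Cauchy_ring_def padic_of_rat_def)
qed

lemma adjoin_ii_cring:
  fixes R (structure)
  assumes "cring R"
  shows "cring (adjoin_ii R)"
proof -
  interpret cring R by fact
  let ?K = "adjoin_ii R"
  have mem: "x \<in> carrier ?K \<longleftrightarrow> fst x \<in> carrier R \<and> snd x \<in> carrier R" for x
    by (cases x) (simp add: adjoin_ii_def)
  have add: "x \<oplus>\<^bsub>?K\<^esub> y = (fst x \<oplus> fst y, snd x \<oplus> snd y)" for x y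
    by (cases x, cases y) (simp add: adjoin_ii_def)
  have mult: "x \<otimes>\<^bsub>?K\<^esub> y = (fst x \<otimes> fst y \<ominus> snd x \<otimes> snd y, fst x \<otimes> snd y \<oplus> snd x \<otimes> fst y)" for x y
    by (cases x, cases y) (simp add: adjoin_ii_def)
  have one: "\<one>\<^bsub>?K\<^esub> = (\<one>, \<zero>)" and zero: "\<zero>\<^bsub>?K\<^esub> = (\<zero>, \<zero>)"
    by (simp_all add: adjoin_ii_def)
  note ops = mem add mult one zero
  note norm = a_minus_def r_distr l_distr minus_add r_minus l_minus a_ac m_ac
  show ?thesis
  proof (rule cringI)
    show "abelian_group ?K"
    proof (rule abelian_groupI)
      fix x assume "x \<in> carrier ?K"
      thus "\<exists>y\<in>carrier ?K. y \<oplus>\<^bsub>?K\<^esub> x = \<zero>\<^bsub>?K\<^esub>"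
        by (intro bexI[of _ "(\<ominus> fst x, \<ominus> snd x)"]) (auto simp: ops l_neg)
    qed (auto simp: ops a_ac)
    show "Group.comm_monoid ?K"
      by (rule comm_monoidI) (simp_all add: ops norm)
  qed (simp add: ops norm)
qed

lemma adjoin_ii_minus:
  fixes R (structure)
  assumes "cring R" "a \<in> carrier R" "b \<in> carrier R" "c \<in> carrier R" "d \<in> carrier R"
  shows "(a, b) \<ominus>\<^bsub>adjoin_ii R\<^esub> (c, d) = (a \<ominus>\<^bsub>R\<^esub> c, b \<ominus>\<^bsub>R\<^esub> d)"
proof -
  interpret cring R by fact
  interpret K: cring "adjoin_ii R" by (rule adjoin_ii_cring[OF assms(1)])
  have "\<ominus>\<^bsub>adjoin_ii R\<^esub> (c, d) = (\<ominus> c, \<ominus> d)"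
    by (rule K.minus_equality) (use assms in \<open>auto simp: adjoin_ii_def l_neg\<close>)
  thus ?thesis by (simp add: a_minus_def) (simp add: adjoin_ii_def)
qed

lemma rat_of_real_of_rat [simp]: "rat_of_real (of_rat q) = q"
  by (simp add: rat_of_real_def)

lemma rat_of_real_diff:
  assumes "x \<in> \<rat>" "y \<in> \<rat>"
  shows "rat_of_real (x - y) = rat_of_real x - rat_of_real y"
  using assms by (auto elim!: Rats_cases simp flip: of_rat_diff)

text \<open>
  For elements of \<open>\<rat>(\<i>)\<close>, the congruence says that both coordinates of the difference
  have \<open>p\<close>-adic absolute value at most \<open>p\<^sup>-\<^sup>r\<close>.
\<close>

lemma padic_gauss_cong_iff:
  assumes p: "prime p" and X: "X \<in> gauss_rats" and Y: "Y \<in> gauss_rats"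
  shows "padic_gauss_cong p r X Y \<longleftrightarrow>
    padic_abs p (rat_of_real (Re (X - Y))) \<le> 1 / real p ^ r \<and>
    padic_abs p (rat_of_real (Im (X - Y))) \<le> 1 / real p ^ r"
proof -
  let ?Q = "padic_numbers p"
  let ?e = "padic_of_rat p"
  interpret cring ?Q by (rule padic_numbers_cring[OF p])
  define P :: rat where "P = of_nat (p ^ r)"
  have P0: "P \<noteq> 0" using p by (auto simp: P_def)
  have normP: "padic_abs p P = 1 / real p ^ r"
    unfolding P_def by (rule padic_abs_power_prime[OF p])
  have pr: "real p ^ r > 0" using p by (simp add: prime_gt_0_nat)
  define d1 where "d1 = rat_of_real (Re (X - Y))"
  define d2 where "d2 = rat_of_real (Im (X - Y))"
  have minus: "?e x \<ominus>\<^bsub>?Q\<^esub> ?e y = ?e (x - y)" for x y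
  proof -
    have "?e x = ?e (x - y) \<oplus>\<^bsub>?Q\<^esub> ?e y" using padic_of_rat_add[OF p, of "x - y" y] by simp
    thus ?thesis by (simp add: a_minus_def a_assoc r_neg)
  qed
  have lhs: "padic_of_gauss p X \<ominus>\<^bsub>padic_gauss_numbers p\<^esub> padic_of_gauss p Y = (?e d1, ?e d2)"
    using X Y unfolding padic_of_gauss_def padic_gauss_numbers_def d1_def d2_def
    by (simp add: adjoin_ii_minus padic_numbers_cring[OF p] minus gauss_rats_def rat_of_real_diff)
  have embP: "padic_of_gauss p (of_nat (p ^ r)) = (?e P, \<zero>\<^bsub>?Q\<^esub>)"
    using rat_of_real_of_rat[of P] rat_of_real_of_rat[of 0]
    by (simp add: padic_of_gauss_def P_def padic_of_rat_0[OF p] of_rat_power del: rat_of_real_of_rat)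
  have rhs: "padic_of_gauss p (of_nat (p ^ r)) \<otimes>\<^bsub>padic_gauss_numbers p\<^esub> (z1, z2) =
      (?e P \<otimes>\<^bsub>?Q\<^esub> z1, ?e P \<otimes>\<^bsub>?Q\<^esub> z2)"
    if "z1 \<in> carrier ?Q" "z2 \<in> carrier ?Q" for z1 z2
    using that unfolding embP padic_gauss_numbers_def by (simp add: adjoin_ii_def a_minus_def)
  have key: "(\<exists>z\<in>padic_ints p. ?e d = ?e P \<otimes>\<^bsub>?Q\<^esub> z) \<longleftrightarrow> padic_abs p d \<le> 1 / real p ^ r" for d
  proof
    assume "\<exists>z\<in>padic_ints p. ?e d = ?e P \<otimes>\<^bsub>?Q\<^esub> z"
    then obtain z where z: "z \<in> carrier ?Q" "padic_norm p z \<le> 1" "?e d = ?e P \<otimes>\<^bsub>?Q\<^esub> z"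
      by (auto simp: padic_ints_def)
    have "padic_abs p d = padic_abs p P * padic_norm p z"
      using arg_cong[OF z(3), of "padic_norm p"] z(1) by (simp add: padic_norm_mult p)
    also have "\<dots> \<le> padic_abs p P * 1" using z(2) by (intro mult_left_mono) auto
    finally show "padic_abs p d \<le> 1 / real p ^ r" by (simp add: normP)
  next
    assume d: "padic_abs p d \<le> 1 / real p ^ r"
    have "padic_abs p d = padic_abs p P * padic_abs p (d / P)"
      using padic_abs_mult[OF p, of P "d / P"] P0 by simp
    hence "padic_abs p (d / P) \<le> 1" using d pr by (simp add: normP field_simps)
    hence "?e (d / P) \<in> padic_ints p" by (simp add: padic_ints_def p)
    moreover have "?e d = ?e P \<otimes>\<^bsub>?Q\<^esub> ?e (d / P)"
      using padic_of_rat_mult[OF p, of P "d / P"] P0 by simp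
    ultimately show "\<exists>z\<in>padic_ints p. ?e d = ?e P \<otimes>\<^bsub>?Q\<^esub> z" by blast
  qed
  have "padic_gauss_cong p r X Y \<longleftrightarrow>
      (\<exists>z1\<in>padic_ints p. \<exists>z2\<in>padic_ints p. ?e d1 = ?e P \<otimes>\<^bsub>?Q\<^esub> z1 \<and> ?e d2 = ?e P \<otimes>\<^bsub>?Q\<^esub> z2)"
  proof -
    have "z \<in> padic_ints p \<Longrightarrow> z \<in> carrier ?Q" for z by (simp add: padic_ints_def)
    moreover have "(\<exists>z\<in>padic_ints p \<times> padic_ints p. Q z) \<longleftrightarrow>
        (\<exists>z1\<in>padic_ints p. \<exists>z2\<in>padic_ints p. Q (z1, z2))" for Q
      by blast
    ultimately show ?thesis
      unfolding padic_gauss_cong_def lhs padic_gauss_ints_def using X Y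
      by (simp add: rhs del: of_nat_power cong: bex_cong)
  qed
  also have "\<dots> \<longleftrightarrow> padic_abs p d1 \<le> 1 / real p ^ r \<and> padic_abs p d2 \<le> 1 / real p ^ r"
    using key[of d1] key[of d2] by blast
  finally show ?thesis unfolding d1_def d2_def .
qed

end

theory Submission
  imports Defs "HOL-Number_Theory.Residues"
begin

text \<open>
  A rational prime \<open>p\<close> congruent to \<open>3\<close> modulo \<open>4\<close> divides \<open>x + \<i>y\<close> iff it divides \<open>x\<close> and
  \<open>y\<close>, and \<open>x + \<i>y\<close> is a \<open>p\<close>-adic unit otherwise. In each of the two products defining the
  big coefficient, the factors divisible by \<open>p\<close> are \<open>p\<close> times the factors of the products for
  \<open>\<R>(A,B;C,D)\<close>, since no carries occur; so this coefficient splits off exactly. It is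
  \<open>p\<close>-integral, because any \<open>C\<close> by \<open>D\<close> rectangle contains at least as many multiples of
  \<open>p\<^sup>k\<close> as the one at the origin (formally, by descent to the quotients by \<open>p\<close>).
  The remaining unit factors are counted by residues modulo \<open>p\<close>: besides complete residue
  systems, which cancel, they consist of the factors of \<open>\<R>(\<alpha>,\<beta>;\<gamma>,\<delta>)\<close>, of full columns
  \<open>\<Prod>s<p. r + \<i>s\<close>, each taken \<open>D\<close> times, and of full rows, each taken \<open>C\<close> times. Substituting
  \<open>s = r t\<close> and using Fermat's little theorem, a full column is congruent to \<open>r\<close> times the column
  of \<open>1\<close>; this produces the binomial coefficients.
\<close>

section \<open>The local ring of Gaussian rationals at an inert prime\<close>

text \<open>For inert \<open>p\<close> this is Z[i] localized at \<open>p\<close>, the intersection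
  of Q(i) with Z_p[i]. Rational integers suffice as denominators, since a Gaussian denominator can
  be multiplied by its conjugate.\<close>

definition local_gauss_ints :: "nat \<Rightarrow> complex set" where
  "local_gauss_ints p =
     {z. \<exists>n a b :: int. \<not> int p dvd n \<and> of_int n * z = of_int a + \<i> * of_int b}"

text \<open>Integrality of both sides is built in; this makes the relation compatible with
  products.\<close>

definition local_cong :: "nat \<Rightarrow> complex \<Rightarrow> complex \<Rightarrow> bool" where
  "local_cong p x y \<longleftrightarrow> x \<in> local_gauss_ints p \<and> y \<in> local_gauss_ints p \<and>
     (x - y) / of_nat p \<in> local_gauss_ints p"

definition local_units :: "nat \<Rightarrow> complex set" where
  "local_units p =
     {z. z \<noteq> 0 \<and> z \<in> local_gauss_ints p \<and> inverse z \<in> local_gauss_ints p}"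

definition gauss_nat :: "nat \<Rightarrow> nat \<Rightarrow> complex" where
  "gauss_nat x y = of_nat x + \<i> * of_nat y"

text \<open>A factor divisible by \<open>p\<close> becomes 1 instead of being divided by its power
  of \<open>p\<close>, so that the value modulo \<open>p\<close> depends only on the residues of
  \<open>x\<close> and \<open>y\<close>.\<close>

definition gauss_unit_part :: "nat \<Rightarrow> nat \<Rightarrow> nat \<Rightarrow> complex" where
  "gauss_unit_part p x y = (if p dvd x \<and> p dvd y then 1 else gauss_nat x y)"

lemma local_gauss_intsI:
  "\<not> int p dvd n \<Longrightarrow> of_int n * z = of_int a + \<i> * of_int b \<Longrightarrow> z \<in> local_gauss_ints p"
  unfolding local_gauss_ints_def by blast

locale inert_prime =
  fixes p :: nat
  assumes prime_p: "prime p" and p_mod_4: "p mod 4 = 3"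
begin

lemma p_pos: "p > 0"
  using prime_p prime_gt_0_nat by blast

lemma local_gauss_ints_of_ints: "of_int a + \<i> * of_int b \<in> local_gauss_ints p"
  using prime_gt_1_nat[OF prime_p] by (intro local_gauss_intsI[of p 1 _ a b]) auto

lemma local_gauss_ints_of_nat [simp]: "of_nat n \<in> local_gauss_ints p"
  using local_gauss_ints_of_ints[of "int n" 0] by simp

lemma local_gauss_ints_1 [simp]: "1 \<in> local_gauss_ints p"
  using local_gauss_ints_of_nat[of 1] by simp

lemma local_gauss_ints_0 [simp]: "0 \<in> local_gauss_ints p"
  using local_gauss_ints_of_nat[of 0] by simp

lemma local_gauss_ints_ii [simp]: "\<i> \<in> local_gauss_ints p"
  using local_gauss_ints_of_ints[of 0 1] by simp

lemma local_gauss_ints_add: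
  assumes "x \<in> local_gauss_ints p" "y \<in> local_gauss_ints p"
  shows "x + y \<in> local_gauss_ints p"
proof -
  obtain n a b where x: "\<not> int p dvd n" "of_int n * x = of_int a + \<i> * of_int b"
    using assms(1) by (auto simp: local_gauss_ints_def)
  obtain m c d where y: "\<not> int p dvd m" "of_int m * y = of_int c + \<i> * of_int d"
    using assms(2) by (auto simp: local_gauss_ints_def)
  have "of_int (n * m) * (x + y) = of_int m * (of_int n * x) + of_int n * (of_int m * y)"
    by (simp add: algebra_simps)
  also have "\<dots> = of_int (m * a + n * c) + \<i> * of_int (m * b + n * d)"
    unfolding x y by (simp add: algebra_simps)
  finally show ?thesis
    by (rule local_gauss_intsI[rotated]) (use x(1) y(1) prime_p in \<open>simp add: prime_dvd_mult_iff\<close>)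
qed

lemma local_gauss_ints_mult:
  assumes "x \<in> local_gauss_ints p" "y \<in> local_gauss_ints p"
  shows "x * y \<in> local_gauss_ints p"
proof -
  obtain n a b where x: "\<not> int p dvd n" "of_int n * x = of_int a + \<i> * of_int b"
    using assms(1) by (auto simp: local_gauss_ints_def)
  obtain m c d where y: "\<not> int p dvd m" "of_int m * y = of_int c + \<i> * of_int d"
    using assms(2) by (auto simp: local_gauss_ints_def)
  have "of_int (n * m) * (x * y) = (of_int n * x) * (of_int m * y)"
    by (simp add: algebra_simps)
  also have "\<dots> = of_int (a * c - b * d) + \<i> * of_int (a * d + b * c)"
    unfolding x y by (simp add: algebra_simps)
  finally show ?thesis
    by (rule local_gauss_intsI[rotated]) (use x(1) y(1) prime_p in \<open>simp add: prime_dvd_mult_iff\<close>)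
qed

lemma local_gauss_ints_uminus: "x \<in> local_gauss_ints p \<Longrightarrow> - x \<in> local_gauss_ints p"
  using local_gauss_ints_mult[of "of_int (-1) + \<i> * of_int 0" x] local_gauss_ints_of_ints[of "-1" 0]
  by simp

lemma local_gauss_ints_prod:
  "(\<And>x. x \<in> S \<Longrightarrow> f x \<in> local_gauss_ints p) \<Longrightarrow> prod f S \<in> local_gauss_ints p"
  by (induction S rule: infinite_finite_induct) (auto intro: local_gauss_ints_mult)

lemma local_gauss_ints_gauss_nat [simp]: "gauss_nat x y \<in> local_gauss_ints p"
  unfolding gauss_nat_def by (intro local_gauss_ints_add local_gauss_ints_mult) auto

section \<open>Units of the local ring\<close>

lemma local_units_imp_ints: "x \<in> local_units p \<Longrightarrow> x \<in> local_gauss_ints p"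
  and local_units_nonzero: "x \<in> local_units p \<Longrightarrow> x \<noteq> 0"
  by (auto simp: local_units_def)

lemma local_units_1 [simp]: "1 \<in> local_units p"
  by (simp add: local_units_def)

lemma local_units_mult: "x \<in> local_units p \<Longrightarrow> y \<in> local_units p \<Longrightarrow> x * y \<in> local_units p"
  by (auto simp: local_units_def intro: local_gauss_ints_mult)

lemma local_units_prod:
  "(\<And>x. x \<in> S \<Longrightarrow> f x \<in> local_units p) \<Longrightarrow> prod f S \<in> local_units p"
  by (induction S rule: infinite_finite_induct) (auto intro: local_units_mult)

lemma local_units_power: "x \<in> local_units p \<Longrightarrow> x ^ n \<in> local_units p"
  by (induction n) (auto intro: local_units_mult)

lemma local_gauss_ints_divide:
  "x \<in> local_gauss_ints p \<Longrightarrow> y \<in> local_units p \<Longrightarrow> x / y \<in> local_gauss_ints p"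
  unfolding divide_inverse by (intro local_gauss_ints_mult) (auto simp: local_units_def)

text \<open>This is where \<open>p mod 4 = 3\<close> enters: -1 is not a square modulo
  \<open>p\<close>, so a nontrivial solution would contradict Fermat's little theorem.\<close>

lemma dvd_sum_two_squares:
  fixes x y :: nat
  assumes "p dvd x\<^sup>2 + y\<^sup>2"
  shows "p dvd x \<and> p dvd y"
proof -
  define k where "k = p div 4"
  have p: "p = 4 * k + 3" using p_mod_4 unfolding k_def by presburger
  have *: "p dvd x" if xy: "p dvd x\<^sup>2 + y\<^sup>2" for x y :: nat
  proof (rule ccontr)
    assume x: "\<not> p dvd x"
    have y: "\<not> p dvd y"
    proof
      assume "p dvd y"
      hence "p dvd x\<^sup>2" using xy by (metis dvd_add_left_iff dvd_trans dvd_triv_left power2_eq_square)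
      thus False using x prime_p prime_dvd_power by blast
    qed
    have "[int x ^ 2 = - (int y ^ 2)] (mod int p)"
      using xy unfolding cong_iff_dvd_diff by (metis diff_minus_eq_add int_dvd_int_iff of_nat_add of_nat_power)
    \<comment> \<open>The exponent is (p - 1)/2. It is odd, so the minus sign survives while both
      squares become (p - 1)-th powers.\<close>
    hence "[(int x ^ 2) ^ (2 * k + 1) = (- (int y ^ 2)) ^ (2 * k + 1)] (mod int p)"
      by (rule cong_pow)
    moreover have "(int x ^ 2) ^ (2 * k + 1) = int x ^ (p - 1)"
        "(- (int y ^ 2)) ^ (2 * k + 1) = - (int y ^ (p - 1))"
      by (simp_all add: p power_minus_odd flip: power_mult power_Suc power_Suc2)
    ultimately have "[int x ^ (p - 1) = - (int y ^ (p - 1))] (mod int p)" by simp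
    moreover have "[int x ^ (p - 1) = 1] (mod int p)" "[int y ^ (p - 1) = 1] (mod int p)"
      using fermat_theorem[OF prime_p x] fermat_theorem[OF prime_p y]
      by (metis cong_int_iff of_nat_1 of_nat_power)+
    ultimately have "[1 = - 1] (mod int p)"
      by (metis cong_minus_minus_iff cong_sym cong_trans)
    hence "int p dvd 2" unfolding cong_iff_dvd_diff by simp
    hence "int p \<le> 2" by (intro zdvd_imp_le) auto
    thus False by (simp add: p)
  qed
  show ?thesis using *[of x y] *[of y x] assms by (simp add: add.commute)
qed

text \<open>The inverse is the conjugate divided by the norm, and the norm is prime to
  \<open>p\<close> by \<open>dvd_sum_two_squares\<close>.\<close>

lemma local_units_gauss_nat:
  assumes "\<not> (p dvd x \<and> p dvd y)"
  shows "gauss_nat x y \<in> local_units p"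
proof -
  have nd: "\<not> p dvd x\<^sup>2 + y\<^sup>2" using dvd_sum_two_squares assms by blast
  have conj: "(of_nat x + \<i> * of_nat y) * (of_nat x - \<i> * of_nat y) = (of_nat (x\<^sup>2 + y\<^sup>2) :: complex)"
    by (simp add: algebra_simps power2_eq_square)
  have ne: "gauss_nat x y \<noteq> 0"
  proof
    assume "gauss_nat x y = 0"
    hence "x\<^sup>2 + y\<^sup>2 = 0" using conj unfolding gauss_nat_def by (metis mult_zero_left of_nat_eq_0_iff)
    thus False using nd by (metis dvd_0_right)
  qed
  have "of_int (int (x\<^sup>2 + y\<^sup>2)) * inverse (gauss_nat x y) =
      of_int (int x) + \<i> * of_int (- int y)"
    using conj ne unfolding gauss_nat_def by (simp add: field_simps)
  hence "inverse (gauss_nat x y) \<in> local_gauss_ints p"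
    by (rule local_gauss_intsI[rotated]) (use nd in \<open>simp only: int_dvd_int_iff not_False_eq_True\<close>)
  thus ?thesis using ne by (simp add: local_units_def)
qed

lemma local_units_of_nat: "\<not> p dvd n \<Longrightarrow> of_nat n \<in> local_units p"
  using local_units_gauss_nat[of n 0] by (simp add: gauss_nat_def)

lemma local_units_gauss_unit_part: "gauss_unit_part p x y \<in> local_units p"
  by (auto simp: gauss_unit_part_def intro: local_units_gauss_nat)

section \<open>Congruences modulo \<open>p\<close> in the local ring\<close>

lemma local_cong_refl: "x \<in> local_gauss_ints p \<Longrightarrow> local_cong p x x"
  by (simp add: local_cong_def)

lemma local_cong_sym: "local_cong p x y \<Longrightarrow> local_cong p y x"
  using local_gauss_ints_uminus[of "(x - y) / of_nat p"]
  by (simp add: local_cong_def minus_divide_left)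

lemma local_cong_trans [trans]: "local_cong p x y \<Longrightarrow> local_cong p y z \<Longrightarrow> local_cong p x z"
  using local_gauss_ints_add[of "(x - y) / of_nat p" "(y - z) / of_nat p"]
  by (simp add: local_cong_def flip: add_divide_distrib)

lemma local_cong_mult:
  assumes "local_cong p x y" "local_cong p u v"
  shows "local_cong p (x * u) (y * v)"
proof -
  have "(x * u - y * v) / of_nat p = (x - y) / of_nat p * u + y * ((u - v) / of_nat p)"
    using p_pos by (simp add: field_simps)
  thus ?thesis using assms
    by (auto simp: local_cong_def intro!: local_gauss_ints_add intro: local_gauss_ints_mult
        simp del: times_divide_eq_left times_divide_eq_right)
qed

lemma local_cong_prod:
  "(\<And>x. x \<in> S \<Longrightarrow> local_cong p (f x) (g x)) \<Longrightarrow> local_cong p (prod f S) (prod g S)"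
  by (induction S rule: infinite_finite_induct) (auto intro: local_cong_mult local_cong_refl)

lemma local_cong_power: "local_cong p x y \<Longrightarrow> local_cong p (x ^ n) (y ^ n)"
  by (induction n) (auto intro: local_cong_mult local_cong_refl)

lemma local_cong_divide:
  assumes "local_cong p x y" "local_cong p u v" "u \<in> local_units p" "v \<in> local_units p"
  shows "local_cong p (x / u) (y / v)"
proof -
  \<comment> \<open>These are the two quotients over the common denominator \<open>u * v\<close>,
    whose inverse is integral.\<close>
  have "local_cong p (v * x * (1 / (u * v))) (u * y * (1 / (u * v)))"
    using assms
    by (intro local_cong_mult local_cong_refl local_gauss_ints_divide local_units_mult)
       (auto intro: local_cong_sym)
  thus ?thesis using assms(3,4)[THEN local_units_nonzero] by (simp add: field_simps)
qed

lemma local_cong_of_nat: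
  assumes "[m = n] (mod p)"
  shows "local_cong p (of_nat m) (of_nat n)"
proof -
  have "int p dvd int m - int n"
    using assms by (simp add: cong_iff_dvd_diff flip: cong_int_iff)
  then obtain k where k: "int m - int n = int p * k" by blast
  have "(of_nat m - of_nat n :: complex) = of_int (int m - int n)" by simp
  also have "\<dots> = of_nat p * of_int k" unfolding k by simp
  finally have "(of_nat m - of_nat n :: complex) / of_nat p = of_int k + \<i> * of_int 0"
    using p_pos by simp
  thus ?thesis unfolding local_cong_def using local_gauss_ints_of_ints[of k 0] by simp
qed

lemma local_cong_gauss_nat:
  assumes "[x = x'] (mod p)" "[y = y'] (mod p)"
  shows "local_cong p (gauss_nat x y) (gauss_nat x' y')"
proof -
  have "(gauss_nat x y - gauss_nat x' y') / of_nat p =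
      (of_nat x - of_nat x') / of_nat p + \<i> * ((of_nat y - of_nat y') / of_nat p)"
    by (simp add: gauss_nat_def algebra_simps diff_divide_distrib add_divide_distrib)
  thus ?thesis using assms[THEN local_cong_of_nat] unfolding local_cong_def
    by (auto intro!: local_gauss_ints_add intro: local_gauss_ints_mult
        simp del: times_divide_eq_left times_divide_eq_right)
qed

lemma local_cong_gauss_unit_part:
  "local_cong p (gauss_unit_part p x y) (gauss_unit_part p (x mod p) (y mod p))"
  by (auto simp: gauss_unit_part_def dvd_mod_iff cong_mod_right
      intro!: local_cong_gauss_nat local_cong_refl)

text \<open>The difference is \<open>p / n\<close> times a Gaussian integer with \<open>n\<close>
  prime to \<open>p\<close>, so both coordinates have \<open>p\<close>-adic absolute value at most
  1/p, which is the criterion \<open>padic_gauss_cong_iff\<close>.\<close>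

lemma local_cong_imp_padic_gauss_cong:
  assumes XY: "local_cong p X Y" and "X \<in> gauss_rats" "Y \<in> gauss_rats"
  shows "padic_gauss_cong p 1 X Y"
proof -
  obtain n a b where n: "\<not> int p dvd n"
    and ab: "of_int n * ((X - Y) / of_nat p) = of_int a + \<i> * of_int b"
    using XY by (auto simp: local_cong_def local_gauss_ints_def)
  have n0: "n \<noteq> 0" using n by auto
  have eq: "X - Y = (of_nat p / of_int n) * (of_int a + \<i> * of_int b)"
    using ab n0 p_pos by (simp add: field_simps)
  also have "\<dots> = complex_of_real (real p / of_int n) * (of_int a + \<i> * of_int b)" by simp
  finally have eq: "X - Y = complex_of_real (real p / of_int n) * (of_int a + \<i> * of_int b)" .
  have re: "Re (X - Y) = of_rat (of_int (int p * a) / of_int n)"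
    unfolding eq by (simp add: of_rat_mult of_rat_divide)
  have im: "Im (X - Y) = of_rat (of_int (int p * b) / of_int n)"
    unfolding eq by (simp add: of_rat_mult of_rat_divide)
  have "padic_abs p (of_int (int p * c) / of_int n) \<le> 1 / real p ^ 1" for c
  proof (cases "c = 0")
    case False
    have nz: "int p * c \<noteq> 0" using False p_pos by simp
    have "multiplicity (int p) n = 0" using n by (rule not_dvd_imp_multiplicity_0)
    moreover have "multiplicity (int p) (int p * c) \<ge> 1"
      using nz prime_gt_1_nat[OF prime_p] by (intro multiplicity_geI) auto
    ultimately have "padic_abs p (of_int (int p * c) / of_int n) \<le> real p powi (- 1)"
      unfolding padic_abs_fraction[OF prime_p nz n0]
      using p_pos by (intro power_int_increasing) auto
    thus ?thesis by (simp add: power_int_minus divide_inverse)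
  qed auto
  thus ?thesis
    using assms prime_p unfolding padic_gauss_cong_iff[OF prime_p assms(2,3)] re im
    by (simp only: rat_of_real_of_rat)
qed

section \<open>Products over rectangles\<close>

text \<open>Intervals open on the left and closed on the right make rounding down exact at both
  ends.\<close>

lemma prod_multiples_in_interval:
  fixes f :: "nat \<Rightarrow> 'a :: comm_monoid_mult"
  shows "(\<Prod>x\<in>{n<..m}. if p dvd x then f x else 1) = (\<Prod>x\<in>{n div p<..m div p}. f (p * x))"
proof -
  have "(\<Prod>x\<in>{n<..m}. if p dvd x then f x else 1) = (\<Prod>x | x \<in> {n<..m} \<and> p dvd x. f x)"
    by (intro prod.inter_filter[symmetric]) simp
  also have "\<dots> = (\<Prod>x\<in>{n div p<..m div p}. f (p * x))"
    using p_pos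
    by (intro prod.reindex_bij_witness[of _ "\<lambda>x. p * x" "\<lambda>x. x div p"])
       (auto simp: div_less_iff_less_mult less_eq_div_iff_mult_less_eq mult.commute elim!: dvdE)
  finally show ?thesis .
qed

text \<open>The points with both coordinates divisible by \<open>p\<close> are \<open>p\<close>
  times the points of the rectangle with bounds divided by \<open>p\<close>; each contributes one
  factor \<open>p\<close>. This is the descent step.\<close>

lemma prod_gauss_nat_eq:
  "(\<Prod>x\<in>{n<..m}. \<Prod>y\<in>{k<..l}. gauss_nat x y) =
     (\<Prod>x\<in>{n<..m}. \<Prod>y\<in>{k<..l}. gauss_unit_part p x y) *
     (of_nat p ^ (l div p - k div p)) ^ (m div p - n div p) *
     (\<Prod>x\<in>{n div p<..m div p}. \<Prod>y\<in>{k div p<..l div p}. gauss_nat x y)"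
proof -
  define u where "u x y = (if p dvd x \<and> p dvd y then gauss_nat x y else 1)" for x y
  have "(\<Prod>x\<in>{n<..m}. \<Prod>y\<in>{k<..l}. gauss_nat x y) =
      (\<Prod>x\<in>{n<..m}. \<Prod>y\<in>{k<..l}. gauss_unit_part p x y) * (\<Prod>x\<in>{n<..m}. \<Prod>y\<in>{k<..l}. u x y)"
    by (auto simp: u_def gauss_unit_part_def simp flip: prod.distrib intro!: prod.cong)
  also have "(\<Prod>x\<in>{n<..m}. \<Prod>y\<in>{k<..l}. u x y) =
      (\<Prod>x\<in>{n<..m}. if p dvd x then \<Prod>y\<in>{k<..l}. if p dvd y then gauss_nat x y else 1 else 1)"
    by (auto simp: u_def intro!: prod.cong)
  also have "\<dots> = (\<Prod>x\<in>{n div p<..m div p}. \<Prod>y\<in>{k div p<..l div p}. gauss_nat (p * x) (p * y))"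
    by (simp only: prod_multiples_in_interval)
  also have "\<dots> = (\<Prod>x\<in>{n div p<..m div p}. \<Prod>y\<in>{k div p<..l div p}. of_nat p * gauss_nat x y)"
    by (simp add: gauss_nat_def algebra_simps)
  also have "\<dots> = (of_nat p ^ (l div p - k div p)) ^ (m div p - n div p) *
      (\<Prod>x\<in>{n div p<..m div p}. \<Prod>y\<in>{k div p<..l div p}. gauss_nat x y)"
    by (simp add: prod.distrib)
  finally show ?thesis by (simp add: mult.assoc)
qed

text \<open>Division by \<open>p\<close> shrinks \<open>C\<close>, which drives the induction; the
  offsets and \<open>D\<close> change along with it and are therefore arbitrary.\<close>

lemma prod_shifted_rectangle_integral:
  "(\<Prod>x\<in>{a<..a + C}. \<Prod>y\<in>{b<..b + D}. gauss_nat x y) /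
   (\<Prod>x\<in>{0<..C}. \<Prod>y\<in>{0<..D}. gauss_nat x y) \<in> local_gauss_ints p"
proof (induction C arbitrary: a b D rule: less_induct)
  case (less C)
  show ?case
  proof (cases "C = 0")
    case False
    define a' b' C' D' where "a' = a div p" and "b' = b div p" and "C' = C div p" and "D' = D div p"
    note defs = a'_def b'_def C'_def D'_def
    define S T where "S = {a'<..(a + C) div p}" and "T = {b'<..(b + D) div p}"
    have "C' < C" using False prime_gt_1_nat[OF prime_p] by (simp add: C'_def)
    note IH = less.IH[OF this, where a = a' and b = b' and D = D']
    define U where "U n m k l = (\<Prod>x\<in>{n<..m}. \<Prod>y\<in>{k<..l}. gauss_unit_part p x y)" for n m k l
    have U: "U n m k l \<in> local_units p" for n m k l
      unfolding U_def by (intro local_units_prod local_units_gauss_unit_part)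
    define G where "G S T = (\<Prod>x\<in>S. \<Prod>y\<in>T. gauss_nat x y)" for S T
    have G: "G S T \<in> local_gauss_ints p" for S T
      unfolding G_def by (intro local_gauss_ints_prod local_gauss_ints_gauss_nat)
    \<comment> \<open>Rounding down is superadditive, so the numerator's quotient rectangle contains
      a \<open>C'\<close> by \<open>D'\<close> rectangle at offset \<open>(a', b')\<close>.\<close>
    have le': "a' + C' \<le> (a + C) div p" "b' + D' \<le> (b + D) div p"
      unfolding defs by (subst div_add1_eq; simp)+
    have le: "C' \<le> (a + C) div p - a'" "D' \<le> (b + D) div p - b'"
      using le' by linarith+
    have sub: "{a'<..a' + C'} \<subseteq> S" "{b'<..b' + D'} \<subseteq> T"
      unfolding S_def T_def using le' by auto
    \<comment> \<open>The factors outside the smaller rectangle form two strips, collected in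
      \<open>r\<close>.\<close>
    have "\<exists>r\<in>local_gauss_ints p. G S T = r * G {a'<..a' + C'} {b'<..b' + D'}"
    proof -
      have "G S T = G (S - {a'<..a' + C'}) T * G {a'<..a' + C'} T"
        unfolding G_def by (intro prod.subset_diff sub) (simp add: S_def)
      also have "G {a'<..a' + C'} T =
          G {a'<..a' + C'} (T - {b'<..b' + D'}) * G {a'<..a' + C'} {b'<..b' + D'}"
        unfolding G_def prod.distrib[symmetric]
        by (intro prod.cong refl prod.subset_diff sub) (simp add: T_def)
      finally show ?thesis using G by (metis local_gauss_ints_mult mult.assoc)
    qed
    then obtain r where r: "r \<in> local_gauss_ints p" "G S T = r * G {a'<..a' + C'} {b'<..b' + D'}"
      by blast
    define P :: complex where "P = (of_nat p ^ ((b + D) div p - b')) ^ ((a + C) div p - a')"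
    define P' where "P' = (of_nat p ^ D' :: complex) ^ C'"
    \<comment> \<open>\<open>e\<close> is the surplus of multiples of \<open>p\<close> in the
      numerator; the inequality below makes the truncated subtraction exact.\<close>
    define e where "e = ((b + D) div p - b') * ((a + C) div p - a') - D' * C'"
    have "D' * C' \<le> ((b + D) div p - b') * ((a + C) div p - a')"
      using le by (intro mult_le_mono)
    hence P: "P = of_nat (p ^ e) * P'"
      unfolding P_def P'_def e_def by (simp flip: power_mult power_add)
    have P'0: "P' \<noteq> 0" using p_pos by (simp add: P'_def)
    \<comment> \<open>One descent step above and below leaves a quotient of units, a power of
      \<open>p\<close>, \<open>r\<close>, and the instance covered by the induction
      hypothesis.\<close>
    have "G {a<..a + C} {b<..b + D} / G {0<..C} {0<..D} =
        (U a (a + C) b (b + D) * P * G S T) / (U 0 C 0 D * P' * G {0<..C'} {0<..D'})"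
      unfolding G_def U_def P_def P'_def S_def T_def
      by (subst (1 2) prod_gauss_nat_eq) (simp add: defs)
    also have "\<dots> = (U a (a + C) b (b + D) / U 0 C 0 D) * of_nat (p ^ e) * r *
        (G {a'<..a' + C'} {b'<..b' + D'} / G {0<..C'} {0<..D'})"
      using P'0 by (simp add: P r field_simps)
    also have "\<dots> \<in> local_gauss_ints p"
    proof (intro local_gauss_ints_mult r(1) local_gauss_ints_of_nat)
      show "U a (a + C) b (b + D) / U 0 C 0 D \<in> local_gauss_ints p"
        by (intro local_gauss_ints_divide local_units_imp_ints U)
    qed (use IH in \<open>simp add: G_def\<close>)
    finally show ?thesis by (simp add: G_def)
  qed auto
qed

section \<open>Reduction to residues modulo \<open>p\<close>\<close>

lemma prod_complete_residues:
  fixes f :: "nat \<Rightarrow> 'a :: comm_monoid_mult"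
  shows "(\<Prod>y\<in>{n<..n + p}. f (y mod p)) = (\<Prod>s<p. f s)"
proof (intro prod.reindex_bij_betw bij_betw_imageI)
  show inj: "inj_on (\<lambda>y. y mod p) {n<..n + p}"
  proof (rule inj_onI)
    fix x y assume xy: "x \<in> {n<..n + p}" "y \<in> {n<..n + p}" "x mod p = y mod p"
    have "[int x = int y] (mod int p)" using xy(3) unfolding cong_int_iff unfolding cong_def .
    hence "int p dvd int x - int y" by (simp add: cong_iff_dvd_diff)
    moreover have "\<bar>int x - int y\<bar> < \<bar>int p\<bar>" using xy(1,2) by auto
    ultimately have "int x - int y = 0" using dvd_imp_le_int leD by blast
    thus "x = y" by simp
  qed
  show "(\<lambda>y. y mod p) ` {n<..n + p} = {..<p}"
    using p_pos by (intro card_subset_eq) (auto simp: card_image[OF inj])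
qed

lemma prod_mod_interval:
  fixes f :: "nat \<Rightarrow> 'a :: comm_monoid_mult"
  shows "(\<Prod>y\<in>{n<..n + (p * D + d)}. f (y mod p)) =
    (\<Prod>s<p. f s) ^ D * (\<Prod>y\<in>{n<..n + d}. f (y mod p))"
proof (induction D)
  case (Suc D)
  define m where "m = n + (p * D + d)"
  \<comment> \<open>A block of \<open>p\<close> integers is removed at the upper end, so the
    remainder stays at \<open>n\<close>.\<close>
  have "{n<..n + (p * Suc D + d)} = {n<..m} \<union> {m<..m + p}" by (auto simp: m_def)
  hence "(\<Prod>y\<in>{n<..n + (p * Suc D + d)}. f (y mod p)) =
      (\<Prod>y\<in>{n<..m}. f (y mod p)) * (\<Prod>y\<in>{m<..m + p}. f (y mod p))"
    by (simp add: prod.union_disjoint disjoint_iff)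
  thus ?case using Suc.IH by (simp add: prod_complete_residues m_def mult_ac)
qed simp

text \<open>For \<open>x\<close> divisible by \<open>p\<close>, only the factor at
  \<open>s = 0\<close> is replaced by 1.\<close>

definition column :: "nat \<Rightarrow> complex" where
  "column x = (\<Prod>s<p. gauss_unit_part p x s)"

definition row :: "nat \<Rightarrow> complex" where
  "row y = (\<Prod>r<p. gauss_unit_part p r y)"

text \<open>The rectangle is cut into \<open>C * D\<close> full squares of side \<open>p\<close>,
  strips of \<open>D\<close> full columns for each leftover \<open>x\<close> and of \<open>C\<close>
  full rows for each leftover \<open>y\<close>, and a \<open>c\<close> by \<open>d\<close>
  corner.\<close>

lemma prod_unit_part_mod:
  "(\<Prod>x\<in>{n<..n + (p * C + c)}. \<Prod>y\<in>{k<..k + (p * D + d)}. gauss_unit_part p (x mod p) (y mod p)) =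
   (\<Prod>r<p. column r) ^ (C * D) * (\<Prod>x\<in>{n<..n + c}. column (x mod p)) ^ D *
   (\<Prod>y\<in>{k<..k + d}. row (y mod p)) ^ C *
   (\<Prod>x\<in>{n<..n + c}. \<Prod>y\<in>{k<..k + d}. gauss_unit_part p (x mod p) (y mod p))"
proof -
  let ?w = "gauss_unit_part p"
  have "(\<Prod>x\<in>{n<..n + (p * C + c)}. \<Prod>y\<in>{k<..k + (p * D + d)}. ?w (x mod p) (y mod p)) =
    (\<Prod>x\<in>{n<..n + (p * C + c)}. column (x mod p) ^ D * (\<Prod>y\<in>{k<..k + d}. ?w (x mod p) (y mod p)))"
    by (simp only: prod_mod_interval column_def)
  also have "\<dots> = (\<Prod>r<p. column r ^ D * (\<Prod>y\<in>{k<..k + d}. ?w r (y mod p))) ^ C *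
     (\<Prod>x\<in>{n<..n + c}. column (x mod p) ^ D * (\<Prod>y\<in>{k<..k + d}. ?w (x mod p) (y mod p)))"
    by (rule prod_mod_interval)
  \<comment> \<open>Exchanging the two products turns the leftover strip into full rows.\<close>
  also have "(\<Prod>r<p. column r ^ D * (\<Prod>y\<in>{k<..k + d}. ?w r (y mod p))) =
      (\<Prod>r<p. column r) ^ D * (\<Prod>y\<in>{k<..k + d}. row (y mod p))"
    unfolding prod.distrib row_def by (subst (2) prod.swap) (simp add: prod_power_distrib)
  finally show ?thesis
    by (simp add: prod.distrib prod_power_distrib power_mult power_mult_distrib mult_ac
        flip: power_mult)
qed

section \<open>Full columns and rows modulo \<open>p\<close>\<close>

lemma prod_mult_residues:
  fixes f :: "nat \<Rightarrow> 'a :: comm_monoid_mult"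
  assumes "\<not> p dvd r"
  shows "(\<Prod>t<p. f (r * t mod p)) = (\<Prod>s<p. f s)"
proof (intro prod.reindex_bij_betw bij_betw_imageI)
  have "coprime r p" using assms prime_p by (metis coprime_commute prime_imp_coprime)
  thus inj: "inj_on (\<lambda>t. r * t mod p) {..<p}"
    using cong_less_modulus_unique_nat
    by (auto simp: inj_on_def cong_mult_lcancel_nat simp flip: cong_def)
  show "(\<lambda>t. r * t mod p) ` {..<p} = {..<p}"
    using p_pos by (intro endo_inj_surj inj) auto
qed

lemma local_cong_power_p: "\<not> p dvd r \<Longrightarrow> local_cong p (of_nat r ^ p) (of_nat r)"
proof -
  assume "\<not> p dvd r"
  hence "[r ^ (p - 1) * r = 1 * r] (mod p)"
    by (intro cong_scalar_right fermat_theorem prime_p)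
  hence "[r ^ p = r] (mod p)" by (simp only: power_minus_mult[OF p_pos] mult_1)
  thus ?thesis using local_cong_of_nat[of "r ^ p" r] by simp
qed

text \<open>With s = r t every factor becomes r (1 + i t) modulo \<open>p\<close>, and Fermat
  reduces the resulting \<open>r ^ p\<close> to \<open>r\<close>. The constant
  \<open>column 1\<close> stays unevaluated because it cancels later.\<close>

lemma column_cong:
  assumes r: "\<not> p dvd r"
  shows "local_cong p (column r) (of_nat r * column 1)"
proof -
  have "column r = (\<Prod>t<p. gauss_unit_part p r (r * t mod p))"
    unfolding column_def by (rule prod_mult_residues[OF r, symmetric])
  also have "local_cong p \<dots> (\<Prod>t<p. of_nat r * gauss_unit_part p 1 t)"
  proof (rule local_cong_prod)
    fix t
    have "of_nat r * gauss_unit_part p 1 t = gauss_nat r (r * t)"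
      using prime_gt_1_nat[OF prime_p] by (simp add: gauss_unit_part_def gauss_nat_def algebra_simps)
    thus "local_cong p (gauss_unit_part p r (r * t mod p)) (of_nat r * gauss_unit_part p 1 t)"
      using r by (auto simp: gauss_unit_part_def intro!: local_cong_gauss_nat)
  qed
  also have "\<dots> = of_nat r ^ p * column 1" by (simp add: prod.distrib column_def)
  also have "local_cong p \<dots> (of_nat r * column 1)"
    unfolding column_def
    by (intro local_cong_mult local_cong_power_p r local_cong_refl local_gauss_ints_prod
        local_units_imp_ints local_units_gauss_unit_part)
  finally show ?thesis .
qed

lemma row_cong:
  assumes s: "\<not> p dvd s"
  shows "local_cong p (row s) (of_nat s * row 1)"
proof -
  have "row s = (\<Prod>t<p. gauss_unit_part p (s * t mod p) s)"
    unfolding row_def by (rule prod_mult_residues[OF s, symmetric])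
  also have "local_cong p \<dots> (\<Prod>t<p. of_nat s * gauss_unit_part p t 1)"
  proof (rule local_cong_prod)
    fix t
    have "of_nat s * gauss_unit_part p t 1 = gauss_nat (s * t) s"
      using prime_gt_1_nat[OF prime_p] by (simp add: gauss_unit_part_def gauss_nat_def algebra_simps)
    thus "local_cong p (gauss_unit_part p (s * t mod p) s) (of_nat s * gauss_unit_part p t 1)"
      using s by (auto simp: gauss_unit_part_def intro!: local_cong_gauss_nat)
  qed
  also have "\<dots> = of_nat s ^ p * row 1" by (simp add: prod.distrib row_def)
  also have "local_cong p \<dots> (of_nat s * row 1)"
    unfolding row_def
    by (intro local_cong_mult local_cong_power_p s local_cong_refl local_gauss_ints_prod
        local_units_imp_ints local_units_gauss_unit_part)
  finally show ?thesis .
qed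

lemma mod_interval_digit:
  assumes "c + d < p" "x \<in> {c<..c + d}"
  shows "(p * a + x) mod p = x"
  using assms by simp

lemma prod_shift:
  fixes f :: "nat \<Rightarrow> 'a :: comm_monoid_mult"
  shows "(\<Prod>x\<in>{m + c<..m + c + d}. f x) = (\<Prod>x\<in>{c<..c + d}. f (m + x))"
  by (rule prod.reindex_bij_witness[of _ "\<lambda>x. m + x" "\<lambda>x. x - m"]) auto

text \<open>On the right the offset survives only through its digits \<open>c\<close> and
  \<open>d\<close>. Hence numerator and denominator share the full squares and the constants
  \<open>column 1\<close> and \<open>row 1\<close>; the denominator is the case of zero
  offset.\<close>

lemma prod_unit_part_cong:
  assumes c: "c + \<gamma> < p" and d: "d + \<delta> < p"
  shows "local_cong p
    (\<Prod>x\<in>{p * a + c<..p * a + c + (p * C + \<gamma>)}. \<Prod>y\<in>{p * b + d<..p * b + d + (p * D + \<delta>)}.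
       gauss_unit_part p x y)
    ((\<Prod>r<p. column r) ^ (C * D) * (column 1 ^ \<gamma>) ^ D * (row 1 ^ \<delta>) ^ C *
     of_nat (\<Prod>{c<..c + \<gamma>}) ^ D * of_nat (\<Prod>{d<..d + \<delta>}) ^ C *
     (\<Prod>x\<in>{c<..c + \<gamma>}. \<Prod>y\<in>{d<..d + \<delta>}. gauss_nat x y))"
    (is "local_cong p ?lhs ?rhs")
proof -
  let ?w = "gauss_unit_part p"
  have w: "?w x y \<in> local_gauss_ints p" for x y
    by (rule local_units_imp_ints[OF local_units_gauss_unit_part])
  have column: "column x \<in> local_gauss_ints p" and row: "row x \<in> local_gauss_ints p" for x
    unfolding column_def row_def by (intro local_gauss_ints_prod w)+
  \<comment> \<open>No carry: the leftover residues lie strictly between 0 and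
    \<open>p\<close>.\<close>
  have ndvd: "\<not> p dvd x" if "x \<in> {c<..c + \<gamma>}" for x using that c by (auto dest!: dvd_imp_le)
  have ndvd': "\<not> p dvd x" if "x \<in> {d<..d + \<delta>}" for x using that d by (auto dest!: dvd_imp_le)
  have "local_cong p ?lhs (\<Prod>x\<in>{p * a + c<..p * a + c + (p * C + \<gamma>)}.
      \<Prod>y\<in>{p * b + d<..p * b + d + (p * D + \<delta>)}. ?w (x mod p) (y mod p))"
    by (intro local_cong_prod local_cong_gauss_unit_part)
  also have "\<dots> = (\<Prod>r<p. column r) ^ (C * D) * (\<Prod>x\<in>{c<..c + \<gamma>}. column x) ^ D *
      (\<Prod>y\<in>{d<..d + \<delta>}. row y) ^ C * (\<Prod>x\<in>{c<..c + \<gamma>}. \<Prod>y\<in>{d<..d + \<delta>}. ?w x y)"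
    unfolding prod_unit_part_mod unfolding prod_shift using c d
    by (simp add: mod_interval_digit cong: prod.cong_simp)
  also have "(\<Prod>x\<in>{c<..c + \<gamma>}. \<Prod>y\<in>{d<..d + \<delta>}. ?w x y) =
      (\<Prod>x\<in>{c<..c + \<gamma>}. \<Prod>y\<in>{d<..d + \<delta>}. gauss_nat x y)"
    by (intro prod.cong refl) (simp add: gauss_unit_part_def ndvd)
  also have "local_cong p ((\<Prod>r<p. column r) ^ (C * D) * (\<Prod>x\<in>{c<..c + \<gamma>}. column x) ^ D *
      (\<Prod>y\<in>{d<..d + \<delta>}. row y) ^ C * (\<Prod>x\<in>{c<..c + \<gamma>}. \<Prod>y\<in>{d<..d + \<delta>}. gauss_nat x y))
     ((\<Prod>r<p. column r) ^ (C * D) * (\<Prod>x\<in>{c<..c + \<gamma>}. of_nat x * column 1) ^ D *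
      (\<Prod>y\<in>{d<..d + \<delta>}. of_nat y * row 1) ^ C *
      (\<Prod>x\<in>{c<..c + \<gamma>}. \<Prod>y\<in>{d<..d + \<delta>}. gauss_nat x y))"
    by (intro local_cong_mult local_cong_power local_cong_prod column_cong row_cong ndvd ndvd'
        local_cong_refl column local_gauss_ints_gauss_nat)
  also have "\<dots> = ?rhs" by (simp add: prod.distrib power_mult_distrib mult_ac)
  finally show ?thesis .
qed

end

section \<open>The congruence for the coefficients\<close>

lemma rect_binom_gauss_nat:
  "rect_binom (a + C) (b + D) C D =
    (\<Prod>x\<in>{a<..a + C}. \<Prod>y\<in>{b<..b + D}. gauss_nat x y) /
    (\<Prod>x\<in>{0<..C}. \<Prod>y\<in>{0<..D}. gauss_nat x y)"
  by (simp add: rect_binom_altdef gauss_nat_def atLeastSucAtMost_greaterThanAtMost)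

text \<open>The factorial does not depend on \<open>c\<close>, so it cancels against the case
  \<open>c = 0\<close> and leaves the binomial coefficient.\<close>

lemma prod_interval_eq_binomial: "\<Prod>{c<..c + d} = (c + d choose d) * fact d" for c d :: nat
proof -
  have "fact (c + d) = fact c * \<Prod>{c<..c + d}"
  proof -
    have "{1..c + d} = {1..c} \<union> {c<..c + d}" by auto
    thus ?thesis by (simp add: fact_prod prod.union_disjoint disjoint_iff)
  qed
  moreover have "fact (c + d) = fact c * ((c + d choose d) * fact d)"
    using binomial_fact_lemma[of d "c + d"] by (simp add: mult_ac)
  ultimately show ?thesis by simp
qed

context inert_prime
begin

lemma rect_binom_local_cong:
  assumes c: "c + \<gamma> < p" and d: "d + \<delta> < p"
  shows "local_cong p
    (rect_binom (p * a + c + (p * C + \<gamma>)) (p * b + d + (p * D + \<delta>)) (p * C + \<gamma>) (p * D + \<delta>))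
    (rect_binom (a + C) (b + D) C D * rect_binom (c + \<gamma>) (d + \<delta>) \<gamma> \<delta> *
      of_nat (c + \<gamma> choose \<gamma>) ^ D * of_nat (d + \<delta> choose \<delta>) ^ C)"
proof -
  define U where "U a c b d = (\<Prod>x\<in>{p * a + c<..p * a + c + (p * C + \<gamma>)}.
    \<Prod>y\<in>{p * b + d<..p * b + d + (p * D + \<delta>)}. gauss_unit_part p x y)" for a c b d
  define M where "M c d = (\<Prod>x\<in>{c<..c + \<gamma>}. \<Prod>y\<in>{d<..d + \<delta>}. gauss_nat x y)" for c d
  define N where "N a b = (\<Prod>x\<in>{a<..a + C}. \<Prod>y\<in>{b<..b + D}. gauss_nat x y)" for a b
  \<comment> \<open>\<open>K\<close> collects what does not depend on the offset and so cancels in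
    the quotient.\<close>
  define K where "K = (\<Prod>r<p. column r) ^ (C * D) * (column 1 ^ \<gamma>) ^ D * (row 1 ^ \<delta>) ^ C"
  define P :: complex where "P = (of_nat p ^ D) ^ C"
  \<comment> \<open>\<open>V c d\<close> is the value to which \<open>U a c b d\<close> reduces
    modulo \<open>p\<close>.\<close>
  define V where "V c d = K * of_nat (\<Prod>{c<..c + \<gamma>}) ^ D * of_nat (\<Prod>{d<..d + \<delta>}) ^ C * M c d" for c d
  have U: "U a c b d \<in> local_units p" for a c b d
    unfolding U_def by (intro local_units_prod local_units_gauss_unit_part)
  have K: "K \<in> local_units p"
    unfolding K_def column_def row_def
    by (intro local_units_mult local_units_power local_units_prod local_units_gauss_unit_part)
  have ndvd: "\<not> p dvd x" if "0 < x" "x < p" for x using that by (auto dest!: dvd_imp_le)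
  have facts: "of_nat (fact \<gamma>) \<in> local_units p" "of_nat (fact \<delta>) \<in> local_units p"
    using c d by (intro local_units_of_nat; simp add: prime_dvd_fact_iff prime_p)+
  have M0: "M 0 0 \<in> local_units p"
    unfolding M_def using c by (intro local_units_prod local_units_gauss_nat) (auto dest!: ndvd)
  have V0: "V 0 0 = K * of_nat (fact \<gamma>) ^ D * of_nat (fact \<delta>) ^ C * M 0 0"
    unfolding V_def prod_interval_eq_binomial by simp
  have VU: "V 0 0 \<in> local_units p"
    unfolding V0 by (intro local_units_mult local_units_power K facts M0)
  \<comment> \<open>Without carries the quotient rectangle has exactly \<open>C\<close> by
    \<open>D\<close> points, so the same power \<open>P\<close> of \<open>p\<close> occurs above and
    below.\<close>
  have split: "(\<Prod>x\<in>{p * a + c<..p * a + c + (p * C + \<gamma>)}.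
      \<Prod>y\<in>{p * b + d<..p * b + d + (p * D + \<delta>)}. gauss_nat x y) = U a c b d * P * N a b"
    if "c + \<gamma> < p" "d + \<delta> < p" for a b c d
  proof -
    have "p * a + c + (p * C + \<gamma>) = (c + \<gamma>) + p * (a + C)"
      "p * b + d + (p * D + \<delta>) = (d + \<delta>) + p * (b + D)" by (simp_all add: algebra_simps)
    hence "(p * a + c + (p * C + \<gamma>)) div p = a + C" "(p * b + d + (p * D + \<delta>)) div p = b + D"
      using that p_pos by (simp_all only: div_mult_self2 div_less add_0_left add_0_right)
    moreover have "(p * a + c) div p = a" "(p * b + d) div p = b" using that p_pos by simp_all
    ultimately show ?thesis by (subst prod_gauss_nat_eq) (simp add: U_def P_def N_def)
  qed
  have P0: "P \<noteq> 0" using p_pos by (simp add: P_def)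
  have "rect_binom (p * a + c + (p * C + \<gamma>)) (p * b + d + (p * D + \<delta>)) (p * C + \<gamma>) (p * D + \<delta>) =
      (U a c b d * P * N a b) / (U 0 0 0 0 * P * N 0 0)"
    unfolding rect_binom_gauss_nat using split[OF c d] split[of 0 0 0 0] c d by simp
  also have "\<dots> = N a b / N 0 0 * (U a c b d / U 0 0 0 0)" using P0 by (simp add: mult_ac)
  \<comment> \<open>\<open>N 0 0\<close> may be divisible by \<open>p\<close>; integrality of
    \<open>N a b / N 0 0\<close> is what allows multiplying the congruence of unit quotients by
    it.\<close>
  also have "local_cong p \<dots> (N a b / N 0 0 * (V c d / V 0 0))"
  proof (rule local_cong_mult[OF local_cong_refl local_cong_divide[OF _ _ U VU]])
    show "N a b / N 0 0 \<in> local_gauss_ints p"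
      unfolding N_def using prod_shifted_rectangle_integral by simp
    show "local_cong p (U a c b d) (V c d)" "local_cong p (U 0 0 0 0) (V 0 0)"
      unfolding U_def V_def K_def M_def by (intro prod_unit_part_cong; use c d in simp)+
  qed
  also have "V c d / V 0 0 = M c d / M 0 0 * of_nat (c + \<gamma> choose \<gamma>) ^ D * of_nat (d + \<delta> choose \<delta>) ^ C"
    using K[THEN local_units_nonzero] unfolding V0
    unfolding V_def prod_interval_eq_binomial by (simp add: power_mult_distrib field_simps)
  finally show ?thesis by (simp add: rect_binom_gauss_nat N_def M_def mult.assoc)
qed

end

theorem theorem1p3:
  fixes p A B C D \<alpha> \<beta> \<gamma> \<delta> :: nat
  assumes "prime p" and "p mod 4 = 3"
    and "1 \<le> C" and "C \<le> A"
    and "1 \<le> D" and "D \<le> B"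
    and "1 \<le> \<gamma>" and "\<gamma> \<le> \<alpha>" and "\<alpha> \<le> p - 1"
    and "1 \<le> \<delta>" and "\<delta> \<le> \<beta>" and "\<beta> \<le> p - 1"
  shows "padic_gauss_cong p 1
    (rect_binom (p * A + \<alpha>) (p * B + \<beta>) (p * C + \<gamma>) (p * D + \<delta>))
    (rect_binom A B C D * rect_binom \<alpha> \<beta> \<gamma> \<delta> *
      of_nat (\<alpha> choose \<gamma>) ^ D * of_nat (\<beta> choose \<delta>) ^ C)"
proof -
  interpret inert_prime p by unfold_locales fact+
  \<comment> \<open>Writing the differences as new variables exhibits each numerator as a shift of
    its denominator.\<close>
  obtain a b c d where *: "A = a + C" "B = b + D" "\<alpha> = c + \<gamma>" "\<beta> = d + \<delta>"
    using assms by (metis add.commute le_Suc_ex)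
  have eq: "p * A + \<alpha> = p * a + c + (p * C + \<gamma>)" "p * B + \<beta> = p * b + d + (p * D + \<delta>)"
    by (simp_all add: * algebra_simps)
  \<comment> \<open>These bounds are the no-carry conditions \<alpha> < p and \<beta> < p.\<close>
  have "c + \<gamma> < p" "d + \<delta> < p" using assms(9,12) p_pos unfolding * by linarith+
  show ?thesis
    unfolding eq unfolding *
    by (intro local_cong_imp_padic_gauss_cong rect_binom_local_cong gauss_rats_mult
        gauss_rats_power gauss_rats_of_nat rect_binom_in_gauss_rats) fact+
qed

end
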